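(* Let $n\ge 2$ and let $\mathcal{Q}$ be a regular $n$-cube circumscribed about a unit $n$-sphere. Let $t_1,\dots,t_k$ be the distinct lengths of the line segments whose endpoints are centers of two distinct facets of $\mathcal{Q}$ (so $k$ is the number of such distinct lengths). Then $$\prod_{i=1}^{k}t_i^2=8 .$$
   Context: A unit $n$-sphere is a sphere of radius $1$ in $\mathbb{R}^n$ (so a "2-sphere" is a circle). An $n$-cube is the regular $n$-dimensional hypercube in $\mathbb{R}^n$; its facets are its $(n-1)$-dimensional faces. It is circumscribed about the sphere if all its facets are tangent to the sphere (they touch the sphere at their centers, and the sphere's center is the center of the cube). *)

theory Defs
  imports "HOL-Analysis.Analysis"
begin

definition regular_cube :: "(real ^ 'n) set \<Rightarrow> bool" where
  "regular_cube Q \<longleftrightarrow>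
     (\<exists>(a :: real ^ 'n) s (f :: real ^ 'n \<Rightarrow> real ^ 'n). s > 0 \<and> orthogonal_transformation f \<and>
        Q = (\<lambda>x. a + s *\<^sub>R f x) ` cbox 0 One)"

text \<open>The center of a cube (in particular of a facet of a cube) is its center of symmetry.
  By \<open>center_eqI\<close> below, a nonempty bounded set has at most one such point; \<open>center S\<close>
  is unspecified for sets without one.\<close>

definition center :: "'a::euclidean_space set \<Rightarrow> 'a" where
  "center S = (THE c. (\<lambda>x. 2 *\<^sub>R c - x) ` S = S)"

text \<open>A facet touches a sphere if the hyperplane it spans meets the sphere in exactly one point
  and that point lies in the facet. For a cube, tangency of all facets already forces the points
  of contact to be the facet centers and the sphere's center to be the center of the cube, so
  these are not required separately.\<close>

definition tangent_to :: "'a::euclidean_space set \<Rightarrow> 'a set \<Rightarrow> bool" where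
  "tangent_to F S \<longleftrightarrow> (\<exists>p \<in> F. affine hull F \<inter> S = {p})"

definition circumscribed_about :: "'a::euclidean_space set \<Rightarrow> 'a set \<Rightarrow> bool" where
  "circumscribed_about Q S \<longleftrightarrow> (\<forall>F. F facet_of Q \<longrightarrow> tangent_to F S)"

definition facet_center_distances :: "'a::euclidean_space set \<Rightarrow> real set" where
  "facet_center_distances Q =
     {dist (center F) (center G) | F G. F facet_of Q \<and> G facet_of Q \<and> F \<noteq> G}"

lemma center_eqI:
  fixes S :: "'a::euclidean_space set"
  assumes "bounded S" "S \<noteq> {}" and c: "(\<lambda>x. 2 *\<^sub>R c - x) ` S = S"
  shows "center S = c"
  unfolding center_def
proof (rule the_equality)
  fix d assume d: "(\<lambda>x. 2 *\<^sub>R d - x) ` S = S"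
  obtain x where x: "x \<in> S" using assms by blast
  have shift: "y + 2 *\<^sub>R (d - c) \<in> S" if "y \<in> S" for y
  proof -
    have "2 *\<^sub>R c - y \<in> S" using c that by blast
    then have "2 *\<^sub>R d - (2 *\<^sub>R c - y) \<in> S" using d by blast
    then show ?thesis by (simp add: algebra_simps)
  qed
  have mem: "x + real k *\<^sub>R (2 *\<^sub>R (d - c)) \<in> S" for k
  proof (induction k)
    case (Suc k)
    then show ?case using shift[OF Suc] by (simp add: algebra_simps)
  qed (simp add: x)
  obtain B where B: "\<And>y. y \<in> S \<Longrightarrow> norm y \<le> B"
    using \<open>bounded S\<close> by (auto simp: bounded_iff)
  have bnd: "real k * norm (2 *\<^sub>R (d - c)) \<le> 2 * B" for k
  proof -
    have "real k * norm (2 *\<^sub>R (d - c)) = norm ((x + real k *\<^sub>R (2 *\<^sub>R (d - c))) - x)"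
      by simp
    also have "\<dots> \<le> norm (x + real k *\<^sub>R (2 *\<^sub>R (d - c))) + norm x"
      by (rule norm_triangle_ineq4)
    finally show ?thesis using B[OF mem[of k]] B[OF x] by linarith
  qed
  show "d = c"
  proof (rule ccontr)
    assume "d \<noteq> c"
    then have "norm (2 *\<^sub>R (d - c)) > 0" by simp
    then obtain k :: nat where "2 * B < real k * norm (2 *\<^sub>R (d - c))"
      using reals_Archimedean3 by blast
    then show False using bnd[of k] by linarith
  qed
qed (rule c)

end

theory Submission
  imports Defs
begin

text \<open>
  A cube with center \<open>m\<close> and half-edge \<open>r\<close> is the set of all \<open>x\<close> with \<open>w \<bullet> (x - m) \<le> r\<close> for every
  \<open>w\<close> in the set \<open>W\<close> of the unit vectors along its axes, taken with both signs. No inequality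
  follows from the others, because \<open>m + 2 r w\<close> violates only the one for \<open>w\<close>; so the facets
  correspond to the vectors of \<open>W\<close> (\<open>facet_of_irredundant_halfspaces\<close>), and the facet for \<open>w\<close>
  is symmetric about \<open>m + r w\<close> (\<open>center_box_facet\<close>).

  A hyperplane that meets a unit sphere in a single point has distance \<open>1\<close> from its center
  (\<open>hyperplane_meets_sphere_once\<close>). Hence the center of the inscribed unit sphere has distance
  \<open>1\<close> from the hyperplanes of two opposite facets, which are \<open>2 r\<close> apart, and so \<open>r = 1\<close>
  (\<open>half_edge_of_circumscribed_box\<close>).

  The distance of two facet centers is therefore \<open>norm (w - w')\<close>. It is \<open>2\<close> if \<open>w' = - w\<close>, and
  otherwise \<open>w\<close> and \<open>w'\<close> are orthogonal and it is \<open>sqrt 2\<close>. From dimension \<open>2\<close> on both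
  distances occur, and the product of their squares is \<open>4 * 2 = 8\<close>.
\<close>

section \<open>Facets and tangent hyperplanes\<close>

text \<open>This transfers \<open>facet_of_polyhedron_explicit\<close>, where the halfspaces form a set and normal
  and offset are functions of the halfspace, to an indexed family of inequalities. If some point violates only the \<open>i\<close>-th
  inequality, then no halfspace occurs twice, so these functions exist, and no halfspace can be
  left out.\<close>

lemma facet_of_irredundant_halfspaces:
  fixes a :: "'i \<Rightarrow> 'a::euclidean_space" and b :: "'i \<Rightarrow> real" and I :: "'i set"
  defines "S \<equiv> {x. \<forall>i\<in>I. a i \<bullet> x \<le> b i}"
  assumes "finite I" and int: "interior S \<noteq> {}"
    and irr: "\<And>i. i \<in> I \<Longrightarrow> \<exists>p. a i \<bullet> p > b i \<and> (\<forall>j\<in>I. j \<noteq> i \<longrightarrow> a j \<bullet> p \<le> b j)"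
  shows "C facet_of S \<longleftrightarrow> (\<exists>i\<in>I. C = S \<inter> {x. a i \<bullet> x = b i})"
proof -
  define H where "H i = {x. a i \<bullet> x \<le> b i}" for i
  have inj: "inj_on H I"
  proof (rule inj_onI, rule ccontr)
    fix i j assume ij: "i \<in> I" "j \<in> I" "H i = H j" "i \<noteq> j"
    obtain p where p: "a i \<bullet> p > b i" "\<And>j. j \<in> I \<Longrightarrow> j \<noteq> i \<Longrightarrow> a j \<bullet> p \<le> b j"
      using irr[OF ij(1)] by blast
    have "p \<notin> H i" using p(1) by (simp add: H_def)
    moreover have "p \<in> H j" using p(2)[OF ij(2)] ij(4) by (simp add: H_def)
    ultimately show False using ij(3) by simp
  qed
  define k where "k = inv_into I H"
  have k: "k (H i) = i" if "i \<in> I" for i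
    using inj that by (simp add: k_def)
  have aff: "affine hull S = UNIV"
    by (rule affine_hull_nonempty_interior[OF int])
  have S: "S = \<Inter> (H ` I)" by (auto simp: S_def H_def)
  have "C facet_of S \<longleftrightarrow> (\<exists>h. h \<in> H ` I \<and> C = S \<inter> {x. a (k h) \<bullet> x = b (k h)})"
  proof (rule facet_of_polyhedron_explicit)
    show "finite (H ` I)" using \<open>finite I\<close> by simp
    show "S = affine hull S \<inter> \<Inter> (H ` I)" using S aff by simp
  next
    fix h assume "h \<in> H ` I"
    then obtain i where i: "i \<in> I" "h = H i" by blast
    obtain s where s: "s \<in> S" using int interior_subset by blast
    obtain p where p: "a i \<bullet> p > b i" using irr i by blast
    have "a i \<bullet> s \<le> b i" using s i by (simp add: S_def)
    with p have "a i \<noteq> 0" by auto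
    then show "a (k h) \<noteq> 0 \<and> h = {x. a (k h) \<bullet> x \<le> b (k h)}"
      using i k by (simp add: H_def)
  next
    fix F assume F: "F \<subset> H ` I"
    then obtain i where i: "i \<in> I" "H i \<notin> F" by blast
    obtain p where p: "a i \<bullet> p > b i" "\<And>j. j \<in> I \<Longrightarrow> j \<noteq> i \<Longrightarrow> a j \<bullet> p \<le> b j"
      using irr i by blast
    have "p \<in> \<Inter> F"
    proof
      fix h assume "h \<in> F"
      with F obtain j where j: "j \<in> I" "h = H j" by blast
      with \<open>h \<in> F\<close> i have "j \<noteq> i" by blast
      with j p show "p \<in> h" by (simp add: H_def)
    qed
    moreover have "p \<notin> S" using p(1) i by (force simp: S_def)
    moreover have "S \<subseteq> \<Inter> F" using F unfolding S by blast
    ultimately show "S \<subset> affine hull S \<inter> \<Inter> F" unfolding aff by blast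
  qed
  also have "\<dots> \<longleftrightarrow> (\<exists>i\<in>I. C = S \<inter> {x. a i \<bullet> x = b i})"
    using k by auto
  finally show ?thesis .
qed

text \<open>The affine hull of a facet has the dimension of a hyperplane, so it fills any hyperplane that
  contains the facet.\<close>

lemma affine_hull_facet_in_hyperplane:
  fixes S :: "'a::euclidean_space set"
  assumes "F facet_of S" "interior S \<noteq> {}" "w \<noteq> 0" "F \<subseteq> {x. w \<bullet> x = b}"
  shows "affine hull F = {x. w \<bullet> x = b}"
proof (rule affine_dim_equal)
  show "affine hull F \<noteq> {}" using assms by (auto simp: facet_of_def)
  show "affine hull F \<subseteq> {x. w \<bullet> x = b}"
    using assms(4) by (simp add: hull_minimal affine_hyperplane)
  have "aff_dim S = int DIM('a)"
    using assms(2) by (simp add: aff_dim_nonempty_interior)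
  then show "aff_dim (affine hull F) = aff_dim {x. w \<bullet> x = b}"
    using assms(1,3) by (simp add: facet_of_def aff_dim_affine_hull aff_dim_hyperplane)
qed (auto simp: affine_hyperplane)

text \<open>The sphere and the hyperplane are both symmetric in the line through the center of the sphere
  that is perpendicular to the hyperplane. So this symmetry fixes a unique common point, which
  must then be the foot of the perpendicular.\<close>

lemma hyperplane_meets_sphere_once:
  fixes c w p :: "'a::euclidean_space"
  assumes "{x. w \<bullet> x = b} \<inter> sphere c \<rho> = {p}" "norm w = 1"
  shows "\<bar>b - w \<bullet> c\<bar> = \<rho>"
proof -
  \<comment> \<open>\<open>d\<close> is the signed distance of the hyperplane from \<open>c\<close>, and \<open>q\<close> is the mirror image of \<open>p\<close>
    in the perpendicular foot \<open>c + d w\<close>.\<close>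
  define d where "d = b - w \<bullet> c"
  define q where "q = 2 *\<^sub>R (c + d *\<^sub>R w) - p"
  have ww: "w \<bullet> w = 1" using assms(2) by (simp add: norm_eq_1)
  have p: "w \<bullet> p = b" "norm (p - c) = \<rho>"
    using assms(1) by (auto simp: dist_norm norm_minus_commute)
  have "w \<bullet> q = b"
    by (simp add: q_def inner_diff_right inner_add_right p ww d_def)
  moreover have "norm (q - c) = \<rho>"
  proof -
    have "q - c = (2 * d) *\<^sub>R w - (p - c)"
      by (simp add: q_def algebra_simps flip: scaleR_2)
    moreover have "w \<bullet> (p - c) = d"
      using p by (simp add: d_def inner_diff_right)
    moreover have "((2 * d) *\<^sub>R w - y) \<bullet> ((2 * d) *\<^sub>R w - y) = y \<bullet> y" if "w \<bullet> y = d" for y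
      using that ww by (simp add: inner_diff_left inner_diff_right inner_commute algebra_simps)
    ultimately have "(q - c) \<bullet> (q - c) = (p - c) \<bullet> (p - c)" by metis
    then show ?thesis using p by (simp add: norm_eq_sqrt_inner)
  qed
  ultimately have "q \<in> {x. w \<bullet> x = b} \<inter> sphere c \<rho>"
    by (simp add: dist_norm norm_minus_commute)
  then have "q = p" using assms(1) by blast
  then have "2 *\<^sub>R (p - c) = 2 *\<^sub>R (d *\<^sub>R w)"
    by (simp add: q_def algebra_simps flip: scaleR_2)
  then have "p - c = d *\<^sub>R w" by (simp only: scaleR_cancel_left) simp
  then show ?thesis using p assms(2) by (simp add: d_def)
qed

section \<open>Boxes around a center\<close>

text \<open>The cube is described by its center and its signed axis directions because this makes all
  facets alike: opposite facets differ only in the sign of the direction.\<close>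

definition axis_directions :: "('a::euclidean_space \<Rightarrow> 'a) \<Rightarrow> 'a set" where
  "axis_directions f = f ` (Basis \<union> uminus ` Basis)"

definition box_around :: "('a::euclidean_space \<Rightarrow> 'a) \<Rightarrow> 'a \<Rightarrow> real \<Rightarrow> 'a set" where
  "box_around f m r = {x. \<forall>w\<in>axis_directions f. w \<bullet> (x - m) \<le> r}"

definition box_facet :: "('a::euclidean_space \<Rightarrow> 'a) \<Rightarrow> 'a \<Rightarrow> real \<Rightarrow> 'a \<Rightarrow> 'a set" where
  "box_facet f m r w = box_around f m r \<inter> {x. w \<bullet> (x - m) = r}"

lemma regular_cube_eq_box_around:
  fixes Q :: "(real ^ 'n) set"
  assumes "regular_cube Q"
  obtains f m r where "r > 0" "orthogonal_transformation f" "Q = box_around f m r"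
proof -
  obtain a s and f :: "real ^ 'n \<Rightarrow> real ^ 'n"
    where s: "s > 0" and f: "orthogonal_transformation f"
      and Q: "Q = (\<lambda>x. a + s *\<^sub>R f x) ` cbox 0 One"
    using assms unfolding regular_cube_def by blast
  have lin: "linear f" and ff: "\<And>v w. f v \<bullet> f w = v \<bullet> w"
    using f by (auto simp: orthogonal_transformation_def)
  define m where "m = a + (s / 2) *\<^sub>R f One"
  have mem: "a + s *\<^sub>R f y \<in> box_around f m (s / 2) \<longleftrightarrow> y \<in> cbox 0 One" for y
  proof -
    have "a + s *\<^sub>R f y - m = s *\<^sub>R f (y - (1 / 2) *\<^sub>R One)"
      by (simp add: m_def linear_diff[OF lin] linear_cmul[OF lin] algebra_simps)
    then have rel: "f v \<bullet> (a + s *\<^sub>R f y - m) = s * (v \<bullet> y - (v \<bullet> One) / 2)" for v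
      by (simp only: inner_scaleR_right ff inner_diff_right) simp
    have coord: "b \<bullet> One = 1" if "b \<in> Basis" for b :: "real ^ 'n"
      using that by (simp add: inner_sum_right inner_Basis if_distrib cong: if_cong)
    have "a + s *\<^sub>R f y \<in> box_around f m (s / 2) \<longleftrightarrow>
        (\<forall>b\<in>Basis. s * (b \<bullet> y - 1 / 2) \<le> s / 2 \<and> s * (1 / 2 - b \<bullet> y) \<le> s / 2)"
      by (simp add: box_around_def axis_directions_def rel ball_Un coord ball_conj_distrib)
    also have "\<dots> \<longleftrightarrow> (\<forall>b\<in>Basis. 0 \<le> b \<bullet> y \<and> b \<bullet> y \<le> 1)"
    proof (rule ball_cong[OF refl])
      fix b :: "real ^ 'n"
      have "s * (b \<bullet> y - 1 / 2) \<le> s * (1 / 2) \<longleftrightarrow> b \<bullet> y - 1 / 2 \<le> 1 / 2"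
        "s * (1 / 2 - b \<bullet> y) \<le> s * (1 / 2) \<longleftrightarrow> 1 / 2 - b \<bullet> y \<le> 1 / 2"
        using s by (simp_all only: mult_le_cancel_left_pos)
      then show "(s * (b \<bullet> y - 1 / 2) \<le> s / 2 \<and> s * (1 / 2 - b \<bullet> y) \<le> s / 2) \<longleftrightarrow>
          (0 \<le> b \<bullet> y \<and> b \<bullet> y \<le> 1)" by auto
    qed
    also have "\<dots> \<longleftrightarrow> y \<in> cbox 0 One"
      by (auto simp: mem_box inner_commute[of y])
    finally show ?thesis .
  qed
  have surj: "\<exists>y. x = a + s *\<^sub>R f y" for x
  proof -
    obtain y where "f y = (1 / s) *\<^sub>R (x - a)"
      using orthogonal_transformation_surj[OF f] by (metis surjD)
    then have "x = a + s *\<^sub>R f y" using s by simp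
    then show ?thesis by blast
  qed
  have "Q = box_around f m (s / 2)"
  proof
    show "Q \<subseteq> box_around f m (s / 2)" unfolding Q using mem by blast
    show "box_around f m (s / 2) \<subseteq> Q"
    proof
      fix x assume "x \<in> box_around f m (s / 2)"
      moreover obtain y where "x = a + s *\<^sub>R f y" using surj by blast
      ultimately show "x \<in> Q" unfolding Q using mem by blast
    qed
  qed
  moreover have "s / 2 > 0" using s by simp
  ultimately show ?thesis using f that by blast
qed

context
  fixes f :: "'a::euclidean_space \<Rightarrow> 'a" and m :: 'a and r :: real
  assumes f: "orthogonal_transformation f" and r: "r > 0"
begin

lemma finite_axis_directions: "finite (axis_directions f)"
  by (simp add: axis_directions_def)

lemma norm_axis_direction: "w \<in> axis_directions f \<Longrightarrow> norm w = 1"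
  using f by (auto simp: axis_directions_def orthogonal_transformation)

lemma uminus_axis_direction:
  assumes "w \<in> axis_directions f"
  shows "- w \<in> axis_directions f"
proof -
  have "f (- v) = - f v" for v
    using f by (simp add: orthogonal_transformation linear_neg)
  moreover obtain v where v: "v \<in> Basis \<union> uminus ` Basis" "w = f v"
    using assms by (auto simp: axis_directions_def)
  moreover have "- v \<in> Basis \<union> uminus ` Basis" using v(1) by auto
  ultimately show ?thesis unfolding axis_directions_def by (metis imageI)
qed

lemma inner_axis_directions:
  assumes "w \<in> axis_directions f" "w' \<in> axis_directions f"
  shows "w \<bullet> w' = (if w' = w then 1 else if w' = - w then - 1 else 0)"
proof -
  have lin: "f (- v) = - f v" and ff: "f v \<bullet> f v' = v \<bullet> v'" for v v'
    using f by (simp_all add: orthogonal_transformation_def linear_neg)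
  have inj: "f v = f v' \<longleftrightarrow> v = v'" for v v'
    using orthogonal_transformation_inj[OF f] by (auto dest: injD)
  obtain v v' where v: "v \<in> Basis \<union> uminus ` Basis" "v' \<in> Basis \<union> uminus ` Basis"
    and w: "w = f v" "w' = f v'"
    using assms by (auto simp: axis_directions_def)
  have "v \<bullet> v' = (if v' = v then 1 else if v' = - v then - 1 else 0)"
    using v by (auto simp: inner_Basis)
  then show ?thesis unfolding w by (simp add: ff inj flip: lin)
qed

lemma interior_box_around: "interior (box_around f m r) \<noteq> {}"
proof -
  have "ball m r \<subseteq> box_around f m r"
  proof
    fix x assume x: "x \<in> ball m r"
    have "w \<bullet> (x - m) \<le> r" if "w \<in> axis_directions f" for w
      using norm_cauchy_schwarz[of w "x - m"] norm_axis_direction[OF that] x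
      by (simp add: dist_norm norm_minus_commute)
    then show "x \<in> box_around f m r" by (simp add: box_around_def)
  qed
  moreover have "m \<in> ball m r" using r by simp
  ultimately show ?thesis using mem_interior[of m "box_around f m r"] r by blast
qed

lemma facet_of_box_around:
  "F facet_of box_around f m r \<longleftrightarrow> (\<exists>w\<in>axis_directions f. F = box_facet f m r w)"
proof -
  have box: "box_around f m r = {x. \<forall>w\<in>axis_directions f. w \<bullet> x \<le> w \<bullet> m + r}"
    by (auto simp: box_around_def inner_diff_right algebra_simps)
  have "\<exists>p. w \<bullet> p > w \<bullet> m + r \<and> (\<forall>w'\<in>axis_directions f. w' \<noteq> w \<longrightarrow> w' \<bullet> p \<le> w' \<bullet> m + r)"
    if "w \<in> axis_directions f" for w
    by (rule exI[of _ "m + (2 * r) *\<^sub>R w"])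
      (use r that in \<open>auto simp: inner_add_right inner_axis_directions\<close>)
  then have "F facet_of box_around f m r \<longleftrightarrow>
      (\<exists>w\<in>axis_directions f. F = box_around f m r \<inter> {x. w \<bullet> x = w \<bullet> m + r})"
    using facet_of_irredundant_halfspaces[where a = "\<lambda>w. w" and b = "\<lambda>w. w \<bullet> m + r",
        OF finite_axis_directions] interior_box_around unfolding box by blast
  then show ?thesis by (simp add: box_facet_def inner_diff_right algebra_simps)
qed

lemma bounded_box_around: "bounded (box_around f m r)"
proof -
  have "box_around f m r \<subseteq> (\<lambda>y. m + f y) ` cbox (- (r *\<^sub>R One)) (r *\<^sub>R One)"
  proof
    fix x assume x: "x \<in> box_around f m r"
    obtain y where y: "f y = x - m"
      using orthogonal_transformation_surj[OF f] by (metis surjD)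
    have "- r \<le> y \<bullet> b \<and> y \<bullet> b \<le> r" if "b \<in> Basis" for b
    proof -
      have "f b \<in> axis_directions f" using that by (auto simp: axis_directions_def)
      then have "f b \<bullet> f y \<le> r" "- f b \<bullet> f y \<le> r"
        using x uminus_axis_direction unfolding box_around_def y by blast+
      then show ?thesis
        using f by (simp add: orthogonal_transformation_def inner_commute)
    qed
    then have "y \<in> cbox (- (r *\<^sub>R One)) (r *\<^sub>R One)" by (simp add: mem_box)
    moreover have "x = m + f y" using y by simp
    ultimately show "x \<in> (\<lambda>y. m + f y) ` cbox (- (r *\<^sub>R One)) (r *\<^sub>R One)" by blast
  qed
  moreover have "bounded ((\<lambda>y. m + f y) ` cbox (- (r *\<^sub>R One)) (r *\<^sub>R One))"
  proof -
    have "bounded (f ` cbox (- (r *\<^sub>R One)) (r *\<^sub>R One))"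
      using f by (intro bounded_linear_image bounded_cbox)
        (simp add: orthogonal_transformation linear_conv_bounded_linear)
    then show ?thesis using bounded_translation[of _ m] by (fastforce simp: image_image)
  qed
  ultimately show ?thesis by (rule bounded_subset[rotated])
qed

text \<open>The reflection in \<open>m + r w\<close> exchanges the inequalities for \<open>w'\<close> and \<open>- w'\<close> whenever \<open>w'\<close> is
  orthogonal to \<open>w\<close>, and it maps the hyperplane of the facet to itself.\<close>

lemma center_box_facet:
  assumes w: "w \<in> axis_directions f"
  shows "center (box_facet f m r w) = m + r *\<^sub>R w"
proof (rule center_eqI)
  let ?\<sigma> = "\<lambda>x. 2 *\<^sub>R (m + r *\<^sub>R w) - x"
  have "bounded (box_around f m r \<inter> {x. w \<bullet> (x - m) = r})"
    using bounded_box_around by (simp add: bounded_Int)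
  then show "bounded (box_facet f m r w)" by (simp add: box_facet_def)
  show "box_facet f m r w \<noteq> {}"
    using facet_of_box_around w by (auto simp: facet_of_def)
  have refl: "?\<sigma> x \<in> box_facet f m r w" if x: "x \<in> box_facet f m r w" for x
  proof -
    have eq: "w' \<bullet> (?\<sigma> x - m) = 2 * r * (w' \<bullet> w) - w' \<bullet> (x - m)" for w'
      by (simp add: inner_diff_right inner_add_right algebra_simps)
    have wx: "w \<bullet> (x - m) = r" using x by (simp add: box_facet_def)
    have on: "w \<bullet> (?\<sigma> x - m) = r"
      unfolding eq wx using w by (simp add: inner_axis_directions)
    have "w' \<bullet> (?\<sigma> x - m) \<le> r" if w': "w' \<in> axis_directions f" for w'
    proof -
      consider "w' = w" | "w' = - w" | "w' \<noteq> w" "w' \<noteq> - w" by blast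
      then show ?thesis
      proof cases
        case 1 then show ?thesis using on by simp
      next
        case 2 then show ?thesis using on r by simp
      next
        case 3
        then have "w \<noteq> - w'" by auto
        with 3 have "w' \<bullet> w = 0" using w w' by (simp add: inner_axis_directions)
        moreover have "- w' \<bullet> (x - m) \<le> r"
          using x uminus_axis_direction[OF w'] unfolding box_facet_def box_around_def by blast
        ultimately show ?thesis unfolding eq by simp
      qed
    qed
    then show ?thesis using on by (simp add: box_facet_def box_around_def)
  qed
  show "?\<sigma> ` box_facet f m r w = box_facet f m r w"
  proof
    show "?\<sigma> ` box_facet f m r w \<subseteq> box_facet f m r w" using refl by blast
    show "box_facet f m r w \<subseteq> ?\<sigma> ` box_facet f m r w"
    proof
      fix x assume "x \<in> box_facet f m r w"
      then have "?\<sigma> x \<in> box_facet f m r w" by (rule refl)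
      moreover have "x = ?\<sigma> (?\<sigma> x)" by simp
      ultimately show "x \<in> ?\<sigma> ` box_facet f m r w" by blast
    qed
  qed
qed

text \<open>With \<open>t = w \<bullet> (m - c)\<close>, the hyperplanes of two opposite facets lie at the signed distances
  \<open>r + t\<close> and \<open>r - t\<close> from \<open>c\<close>. Both have absolute value \<open>1\<close>, and their sum \<open>2 r\<close> is positive.\<close>

lemma half_edge_of_circumscribed_box:
  assumes circ: "circumscribed_about (box_around f m r) (sphere c 1)"
  shows "r = 1"
proof -
  have tangent: "\<bar>r + w \<bullet> (m - c)\<bar> = 1" if w: "w \<in> axis_directions f" for w
  proof -
    have facet: "box_facet f m r w facet_of box_around f m r"
      using facet_of_box_around w by blast
    have sub: "box_facet f m r w \<subseteq> {x. w \<bullet> x = w \<bullet> m + r}"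
      by (auto simp: box_facet_def inner_diff_right)
    have "w \<noteq> 0" using norm_axis_direction[OF w] by auto
    then have "affine hull box_facet f m r w = {x. w \<bullet> x = w \<bullet> m + r}"
      using affine_hull_facet_in_hyperplane[OF facet interior_box_around _ sub] by simp
    then obtain p where "{x. w \<bullet> x = w \<bullet> m + r} \<inter> sphere c 1 = {p}"
      using circ facet unfolding circumscribed_about_def tangent_to_def by metis
    then have "\<bar>w \<bullet> m + r - w \<bullet> c\<bar> = 1"
      by (rule hyperplane_meets_sphere_once) (rule norm_axis_direction[OF w])
    then show ?thesis by (simp add: inner_diff_right algebra_simps)
  qed
  obtain b :: 'a where "b \<in> Basis" using nonempty_Basis by blast
  then have w: "f b \<in> axis_directions f" by (simp add: axis_directions_def)
  show ?thesis
    using tangent[OF w] tangent[OF uminus_axis_direction[OF w]] r by (simp add: abs_if split: if_splits)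
qed

lemma dist_center_box_facets:
  assumes w: "w \<in> axis_directions f" "w' \<in> axis_directions f" and "w \<noteq> w'"
  shows "dist (center (box_facet f m r w)) (center (box_facet f m r w')) =
    (if w' = - w then 2 * r else sqrt 2 * r)"
proof -
  have "dist (m + r *\<^sub>R w) (m + r *\<^sub>R w') = r * norm (w - w')"
    using r by (simp add: dist_norm flip: scaleR_diff_right)
  also have "\<dots> = r * sqrt ((w - w') \<bullet> (w - w'))"
    by (simp only: norm_eq_sqrt_inner)
  also have "(w - w') \<bullet> (w - w') = 2 - 2 * (w \<bullet> w')"
    using w by (simp add: inner_diff_left inner_diff_right inner_commute inner_axis_directions)
  also have "\<dots> = (if w' = - w then 4 else 2)"
    using w \<open>w \<noteq> w'\<close> by (simp add: inner_axis_directions)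
  finally show ?thesis using w by (simp add: center_box_facet)
qed

lemma facet_center_distances_box_around:
  assumes dim: "DIM('a) \<ge> 2"
  shows "facet_center_distances (box_around f m r) = {2 * r, sqrt 2 * r}"
proof
  show "facet_center_distances (box_around f m r) \<subseteq> {2 * r, sqrt 2 * r}"
  proof
    fix t assume "t \<in> facet_center_distances (box_around f m r)"
    then obtain w w' where "w \<in> axis_directions f" "w' \<in> axis_directions f"
      "box_facet f m r w \<noteq> box_facet f m r w'"
      "t = dist (center (box_facet f m r w)) (center (box_facet f m r w'))"
      unfolding facet_center_distances_def facet_of_box_around by blast
    moreover from this have "w \<noteq> w'" by blast
    ultimately show "t \<in> {2 * r, sqrt 2 * r}"
      using dist_center_box_facets[of w w'] by simp
  qed
next
  have distance: "(if w' = - w then 2 * r else sqrt 2 * r)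
      \<in> facet_center_distances (box_around f m r)"
    if w: "w \<in> axis_directions f" "w' \<in> axis_directions f" "w \<noteq> w'" for w w'
  proof -
    note d = dist_center_box_facets[OF w]
    \<comment> \<open>Facets with different normals are distinct because their centers are.\<close>
    have "box_facet f m r w \<noteq> box_facet f m r w'"
    proof
      assume "box_facet f m r w = box_facet f m r w'"
      with d r show False by (simp split: if_splits)
    qed
    moreover have "box_facet f m r w facet_of box_around f m r"
      "box_facet f m r w' facet_of box_around f m r"
      using facet_of_box_around w by blast+
    ultimately show ?thesis unfolding facet_center_distances_def d[symmetric] by blast
  qed
  have "\<not> card (Basis :: 'a set) \<le> Suc 0" using dim by simp
  then obtain b b' :: 'a where b: "b \<in> Basis" "b' \<in> Basis" "b \<noteq> b'"
    unfolding card_le_Suc0_iff_eq[OF finite_Basis] by blast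
  then have w: "f b \<in> axis_directions f" "f b' \<in> axis_directions f"
    by (simp_all add: axis_directions_def)
  have "f b \<bullet> f b' = 0" "f b \<bullet> f b = 1" "f b \<bullet> (- f b) = - 1"
    using b f by (simp_all add: orthogonal_transformation_def inner_Basis)
  then have neq: "f b \<noteq> f b'" "f b' \<noteq> - f b" "f b \<noteq> - f b"
    by fastforce+
  have "2 * r \<in> facet_center_distances (box_around f m r)"
    using distance[OF w(1) uminus_axis_direction[OF w(1)]] neq by simp
  moreover have "sqrt 2 * r \<in> facet_center_distances (box_around f m r)"
    using distance[OF w neq(1)] neq by simp
  ultimately show "{2 * r, sqrt 2 * r} \<subseteq> facet_center_distances (box_around f m r)" by simp
qed

end

section \<open>The product of the squared distances\<close>

theorem corollary6p2:
  fixes Q :: "(real ^ 'n) set" and c :: "real ^ 'n"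
  assumes "CARD('n) \<ge> 2"
    and "regular_cube Q"
    and "circumscribed_about Q (sphere c 1)"
  shows "finite (facet_center_distances Q) \<and> (\<Prod>t\<in>facet_center_distances Q. t\<^sup>2) = 8"
proof -
  obtain f :: "real ^ 'n \<Rightarrow> real ^ 'n" and m r
    where r: "r > 0" and f: "orthogonal_transformation f" and Q: "Q = box_around f m r"
    using regular_cube_eq_box_around[OF assms(2)] by blast
  have "r = 1"
    using half_edge_of_circumscribed_box[OF f r] assms(3) unfolding Q by blast
  then have D: "facet_center_distances Q = {2, sqrt 2}"
    using facet_center_distances_box_around[OF f r] assms(1) unfolding Q by simp
  have "sqrt 2 \<noteq> (2::real)" using sqrt2_less_2 by simp
  then show ?thesis unfolding D by simp
qed

end
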